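(* Let $f:\mathbb{R}^n\to\mathbb{R}$ be convex, twice continuously differentiable, coercive, and strongly convex on bounded subsets of $\mathbb{R}^n$. Fix $\beta>0$, $x_0,\dot x_0\in\mathbb{R}^n$, and initial values $\varepsilon_0>0$, $\varepsilon_0'\le 0$, $\alpha_0\ge0$. Let $x_N:[0,+\infty)\to\mathbb{R}^n$ be the solution of $$\beta\nabla^2f(x_N(t))\dot x_N(t)+\nabla f(x_N(t))=0,\quad t\ge0,\qquad x_N(0)=x_0,$$ and let $c_1,c_2\ge0$. There exist $C_0,C_1,C_2\ge0$, depending on $c_1,c_2$ (and on the fixed data above, but not otherwise on $\varepsilon$ and $\alpha$), such that for every pair of functions $\varepsilon,\alpha:[0,+\infty)\to\mathbb{R}$ satisfying (a) $\alpha$ is non-increasing, non-negative, differentiable, with $\alpha(0)=\alpha_0$; $\varepsilon$ is non-increasing, positive, twice differentiable with bounded second derivative, with $\varepsilon(0)=\varepsilon_0$ and $\varepsilon'(0)=\varepsilon_0'$; (b) for all $t\ge0$, $|\varepsilon'(t)|\le c_1\varepsilon(t)$ and $\alpha(t)\le c_2\varepsilon(t)$; the solution $x:[0,+\infty)\to\mathbb{R}^n$ of $$\varepsilon(t)\ddot x(t)+\alpha(t)\dot x(t)+\beta\nabla^2 f(x(t))\dot x(t)+\nabla f(x(t))=0,\quad t\ge 0,\qquad (x(0),\dot x(0))=(x_0,\dot x_0),$$ satisfies, for all $t\ge0$, $$\|x(t)-x_N(t)\|\le C_0e^{-\frac t\beta}\varepsilon_0\|\dot x_0\|+C_1\sq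rt{\varepsilon(t)}+C_2\int_0^te^{\frac1\beta(s-t)}\sqrt{\varepsilon(s)}\,\mathrm{d}s.$$
   Context: $\mathbb{R}^n$ is equipped with a scalar product $\langle\cdot,\cdot\rangle$ and the induced norm $\|\cdot\|$. Coercive means $f(y)\to+\infty$ as $\|y\|\to+\infty$. Strongly convex on bounded subsets means that for every bounded set $K\subset\mathbb{R}^n$ there is $\mu_K>0$ such that $\langle\nabla f(y_1)-\nabla f(y_2),y_1-y_2\rangle\ge\mu_K\|y_1-y_2\|^2$ for all $y_1,y_2\in K$. Dots denote time derivatives. Under these assumptions both initial value problems have unique global solutions on $[0,+\infty)$. *)

theory Defs
  imports "HOL-Analysis.Analysis"
begin

text \<open>The gradient is the Riesz representative of the Frechet derivative with respect to the inner
  product of the space. It is only meaningful where the function is differentiable.\<close>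

definition grad :: "('a::euclidean_space \<Rightarrow> real) \<Rightarrow> 'a \<Rightarrow> 'a" where
  "grad f y = (THE D. GDERIV f y :> D)"

definition hess :: "('a::euclidean_space \<Rightarrow> real) \<Rightarrow> 'a \<Rightarrow> 'a \<Rightarrow> 'a" where
  "hess f y = frechet_derivative (grad f) (at y)"

text \<open>\<open>Blinfun\<close> turns the (bounded linear) operator \<open>hess f y\<close> into an element of the normed
  space of operators, so that continuity is meant in the operator norm.\<close>

definition twice_continuously_differentiable :: "('a::euclidean_space \<Rightarrow> real) \<Rightarrow> bool" where
  "twice_continuously_differentiable f \<longleftrightarrow>
     (\<forall>y. f differentiable (at y)) \<and>
     (\<forall>y. grad f differentiable (at y)) \<and>
     continuous_on UNIV (\<lambda>y. Blinfun (hess f y))"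

definition coercive :: "('a::euclidean_space \<Rightarrow> real) \<Rightarrow> bool" where
  "coercive f \<longleftrightarrow> filterlim f at_top at_infinity"

definition strongly_convex_on_bounded :: "('a::euclidean_space \<Rightarrow> real) \<Rightarrow> bool" where
  "strongly_convex_on_bounded f \<longleftrightarrow>
     (\<forall>K. bounded K \<longrightarrow> (\<exists>\<mu>>0. \<forall>y1\<in>K. \<forall>y2\<in>K.
        (grad f y1 - grad f y2) \<bullet> (y1 - y2) \<ge> \<mu> * (norm (y1 - y2))\<^sup>2))"

text \<open>Functions of time live on \<open>[0, \<infinity>)\<close>. They are total functions here, of which only the values on
  \<open>{0..}\<close> matter; in particular the time derivative at \<open>0\<close> is one-sided.\<close>

definition tderiv :: "(real \<Rightarrow> 'b::real_normed_vector) \<Rightarrow> real \<Rightarrow> 'b" where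
  "tderiv u t = vector_derivative u (at t within {0..})"

definition newton_solution ::
    "('a::euclidean_space \<Rightarrow> real) \<Rightarrow> real \<Rightarrow> 'a \<Rightarrow> (real \<Rightarrow> 'a) \<Rightarrow> bool" where
  "newton_solution f \<beta> x0 x \<longleftrightarrow>
     x differentiable_on {0..} \<and>
     (\<forall>t\<ge>0. \<beta> *\<^sub>R hess f (x t) (tderiv x t) + grad f (x t) = 0) \<and>
     x 0 = x0"

definition inertial_solution ::
    "('a::euclidean_space \<Rightarrow> real) \<Rightarrow> real \<Rightarrow> (real \<Rightarrow> real) \<Rightarrow> (real \<Rightarrow> real) \<Rightarrow> 'a \<Rightarrow> 'a \<Rightarrow>
     (real \<Rightarrow> 'a) \<Rightarrow> bool" where
  "inertial_solution f \<beta> \<epsilon> \<alpha> x0 v0 x \<longleftrightarrow>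
     x differentiable_on {0..} \<and>
     tderiv x differentiable_on {0..} \<and>
     (\<forall>t\<ge>0. \<epsilon> t *\<^sub>R tderiv (tderiv x) t + \<alpha> t *\<^sub>R tderiv x t
        + \<beta> *\<^sub>R hess f (x t) (tderiv x t) + grad f (x t) = 0) \<and>
     x 0 = x0 \<and> tderiv x 0 = v0"

end

theory Submission
  imports Defs
begin

text \<open>Both equations become linear in the gradient. For the Newton flow, \<open>\<nabla>f(x\<^sub>N)\<close> solves
  \<open>w' = - w / \<beta>\<close>; for the inertial flow, \<open>w = \<epsilon> x' + \<beta> \<nabla>f(x)\<close> solves
  \<open>w' + w / \<beta> = (\<epsilon>' - \<alpha> + \<epsilon> / \<beta>) x'\<close>, whose right-hand side is of size \<open>\<epsilon> \<bar>x'\<bar>\<close> by (b).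
  The energy \<open>f(x) + \<epsilon> \<bar>x'\<bar>\<^sup>2 / 2\<close> is non-increasing, so by coercivity both trajectories stay in a
  fixed ball and \<open>\<epsilon> \<bar>x'\<bar>\<close> is of size \<open>\<surd>\<epsilon>\<close>. Variation of constants then bounds the difference of the
  two gradients, and strong convexity on the ball turns this into a bound on the distance.\<close>

section \<open>Calculus of the gradient and the Hessian\<close>

text \<open>As a definite description, \<open>grad\<close> carries no information until a
  representative is shown to exist and to be unique. Existence is the Riesz representation in finite
  dimension, summing over the orthonormal basis; uniqueness is inherited from the
  derivative.\<close>

lemma has_derivative_grad:
  fixes f :: "'a::euclidean_space \<Rightarrow> real"
  assumes "f differentiable (at y)"
  shows "(f has_derivative (\<lambda>h. grad f y \<bullet> h)) (at y)"
proof -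
  obtain f' where f': "(f has_derivative f') (at y)"
    using assms unfolding differentiable_def by blast
  interpret f': linear f'
    using f' by (rule has_derivative_linear)
  have repr: "h \<bullet> (\<Sum>b\<in>Basis. f' b *\<^sub>R b) = f' h" for h
  proof -
    have "f' h = f' (\<Sum>b\<in>Basis. (h \<bullet> b) *\<^sub>R b)"
      by (simp add: euclidean_representation)
    also have "\<dots> = h \<bullet> (\<Sum>b\<in>Basis. f' b *\<^sub>R b)"
      by (simp add: f'.sum f'.scaleR inner_sum_right mult.commute)
    finally show ?thesis by simp
  qed
  have ex: "GDERIV f y :> (\<Sum>b\<in>Basis. f' b *\<^sub>R b)"
    unfolding gderiv_def using f' by (simp add: repr)
  have uniq: "D = D'" if "GDERIV f y :> D" "GDERIV f y :> D'" for D D'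
    using has_derivative_unique[OF that[unfolded gderiv_def]]
    by (intro vector_eq_rdot[THEN iffD1]) (metis inner_commute)
  have "GDERIV f y :> grad f y"
    unfolding grad_def by (rule theI'[OF ex1I]) (use ex uniq in blast)+
  then show ?thesis
    unfolding gderiv_def by (simp add: inner_commute)
qed

lemma has_vector_derivative_comp_grad:
  fixes f :: "'a::euclidean_space \<Rightarrow> real"
  assumes "f differentiable (at (x t))" "(x has_vector_derivative v) (at t within S)"
  shows "((\<lambda>s. f (x s)) has_vector_derivative grad f (x t) \<bullet> v) (at t within S)"
  using has_derivative_compose[OF assms(2)[unfolded has_vector_derivative_def]
      has_derivative_grad[OF assms(1)]]
  by (simp add: has_vector_derivative_def)

lemma has_vector_derivative_comp_hess:
  fixes f :: "'a::euclidean_space \<Rightarrow> real"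
  assumes "grad f differentiable (at (x t))" "(x has_vector_derivative v) (at t within S)"
  shows "((\<lambda>s. grad f (x s)) has_vector_derivative hess f (x t) v) (at t within S)"
proof -
  have d: "(grad f has_derivative hess f (x t)) (at (x t))"
    using assms(1) unfolding hess_def by (simp add: frechet_derivative_works)
  show ?thesis
    using has_derivative_compose[OF assms(2)[unfolded has_vector_derivative_def] d]
      linear_scale[OF has_derivative_linear[OF d]]
    by (simp add: has_vector_derivative_def)
qed

text \<open>The quadratic form is the limit of difference quotients of the gradient along the line
  through \<open>y\<close> in direction \<open>v\<close>, and monotonicity fixes their sign. This is
  the source of dissipation in both energy estimates.\<close>

lemma hess_nonneg:
  fixes f :: "'a::euclidean_space \<Rightarrow> real"
  assumes diff: "grad f differentiable (at y)"
    and mono: "\<And>y1 y2. (grad f y1 - grad f y2) \<bullet> (y1 - y2) \<ge> 0"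
  shows "hess f y v \<bullet> v \<ge> 0"
proof -
  have "((\<lambda>s. y + s *\<^sub>R v) has_vector_derivative v) (at 0)"
    by (auto intro!: derivative_eq_intros)
  then have "((\<lambda>s. grad f (y + s *\<^sub>R v)) has_vector_derivative hess f y v) (at 0)"
    using has_vector_derivative_comp_hess[of f "\<lambda>s. y + s *\<^sub>R v" 0 v UNIV] diff by simp
  then have "((\<lambda>s. grad f (y + s *\<^sub>R v) \<bullet> v) has_vector_derivative hess f y v \<bullet> v) (at 0)"
    by (rule bounded_linear.has_vector_derivative[OF bounded_linear_inner_left])
  then have "((\<lambda>s. (grad f (y + s *\<^sub>R v) \<bullet> v - grad f y \<bullet> v) / s) \<longlongrightarrow> hess f y v \<bullet> v) (at 0)"
    by (simp add: has_real_derivative_iff_has_vector_derivative[symmetric] DERIV_def)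
  \<comment> \<open>Expanding the fraction by \<open>s\<close> makes the denominator a square, so
    the sign of \<open>s\<close> is harmless. At \<open>s = 0\<close> the quotient is 0 by the
    convention for division.\<close>
  moreover have "(grad f (y + s *\<^sub>R v) \<bullet> v - grad f y \<bullet> v) / s \<ge> 0" for s :: real
  proof (cases "s = 0")
    case False
    have "(grad f (y + s *\<^sub>R v) \<bullet> v - grad f y \<bullet> v) / s
        = (grad f (y + s *\<^sub>R v) - grad f y) \<bullet> (s *\<^sub>R v) / s\<^sup>2"
      using False by (simp add: inner_diff_left power2_eq_square)
    moreover have "(grad f (y + s *\<^sub>R v) - grad f y) \<bullet> (s *\<^sub>R v) \<ge> 0"
      using mono[of "y + s *\<^sub>R v" y] by simp
    ultimately show ?thesis by simp
  qed simp
  ultimately show ?thesis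
    by (intro tendsto_lowerbound) (auto intro: always_eventually)
qed

section \<open>Derivatives on the half-line and the linear decay estimate\<close>

lemma has_vector_derivative_tderiv:
  fixes x :: "real \<Rightarrow> 'b::real_normed_vector"
  assumes "x differentiable_on {0..}" "t \<ge> 0"
  shows "(x has_vector_derivative tderiv x t) (at t within {0..})"
  using assms by (auto simp: tderiv_def differentiable_on_def vector_derivative_works[symmetric])

lemma antimono_on_tderiv_nonpos:
  fixes u :: "real \<Rightarrow> real"
  assumes anti: "antimono_on {0..} u" and "u differentiable_on {0..}" "t \<ge> 0"
  shows "tderiv u t \<le> 0"
proof -
  have "((\<lambda>s. (u s - u t) / (s - t)) \<longlongrightarrow> tderiv u t) (at t within {0..})"
    using has_vector_derivative_tderiv[OF assms(2,3)]
    by (simp add: has_real_derivative_iff_has_vector_derivative[symmetric] has_field_derivative_iff)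
  moreover have "(u s - u t) / (s - t) \<le> 0" if "s \<ge> 0" for s
    using monotone_onD[OF anti, of s t] monotone_onD[OF anti, of t s] that \<open>t \<ge> 0\<close>
    by (cases s t rule: linorder_cases) (auto simp: divide_simps)
  then have "\<forall>\<^sub>F s in at t within {0..}. (u s - u t) / (s - t) \<le> 0"
    by (auto simp: eventually_at_filter)
  \<comment> \<open>Passing an inequality to the limit requires a non-trivial filter. Points to the
    right of \<open>t\<close> provide this even at \<open>t = 0\<close>, where the derivative is
    one-sided.\<close>
  moreover have "at_right t \<le> at t within {0..}"
    using \<open>t \<ge> 0\<close> by (intro at_le) auto
  then have "at t within {0..} \<noteq> bot"
    using trivial_limit_at_right_real[of t] by (metis bot.extremum_uniqueI)
  ultimately show ?thesis
    by (intro tendsto_upperbound)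
qed

text \<open>The gauge integral integrates every derivative, so the pointwise sign of
  \<open>u'\<close> suffices. It is applied to the energies of the two flows.\<close>

lemma has_vector_derivative_nonpos_imp_le:
  fixes u :: "real \<Rightarrow> real"
  assumes "\<And>s. s \<ge> 0 \<Longrightarrow> (u has_vector_derivative u' s) (at s within {0..})"
    and "\<And>s. s \<ge> 0 \<Longrightarrow> u' s \<le> 0" and "t \<ge> 0"
  shows "u t \<le> u 0"
proof -
  have "(u' has_integral (u t - u 0)) {0..t}"
    by (intro fundamental_theorem_of_calculus)
       (use assms in \<open>auto intro: has_vector_derivative_within_subset[OF assms(1)]\<close>)
  then have "u t - u 0 \<le> 0"
    by (rule has_integral_le[OF _ has_integral_0]) (use assms in auto)
  then show ?thesis by simp
qed

text \<open>Variation of constants: multiplying by \<open>exp (a * (s - t))\<close> absorbs the term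
  in \<open>a\<close>, and integrating over \<open>{0..t}\<close> leaves only the weighted forcing
  \<open>r\<close>. The factor equals 1 at \<open>s = t\<close>, so the kernel of the final estimate
  appears directly.\<close>

lemma linear_decay_bound:
  fixes w r :: "real \<Rightarrow> 'a::euclidean_space"
  assumes w: "\<And>s. s \<ge> 0 \<Longrightarrow> (w has_vector_derivative r s - a *\<^sub>R w s) (at s within {0..})"
    and r: "\<And>s. s \<ge> 0 \<Longrightarrow> norm (r s) \<le> k s"
    and k: "continuous_on {0..} k"
    and "t \<ge> 0"
  shows "norm (w t - exp (- a * t) *\<^sub>R w 0) \<le> integral {0..t} (\<lambda>s. exp (a * (s - t)) * k s)"
proof -
  have "((\<lambda>s. exp (a * (s - t)) *\<^sub>R w s) has_vector_derivative exp (a * (s - t)) *\<^sub>R r s)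
      (at s within {0..t})" if "s \<in> {0..t}" for s
  proof -
    have "(w has_vector_derivative r s - a *\<^sub>R w s) (at s within {0..t})"
      using w[of s] that by (auto intro: has_vector_derivative_within_subset)
    then show ?thesis
      by (auto intro!: derivative_eq_intros simp: algebra_simps)
  qed
  \<comment> \<open>Besides the value of the integral, this yields integrability of the weighted
    \<open>r\<close>, about which only a pointwise bound is assumed.\<close>
  then have int: "((\<lambda>s. exp (a * (s - t)) *\<^sub>R r s) has_integral
      (exp (a * (t - t)) *\<^sub>R w t - exp (a * (0 - t)) *\<^sub>R w 0)) {0..t}"
    using \<open>t \<ge> 0\<close> by (intro fundamental_theorem_of_calculus) auto
  have "continuous_on {0..t} k"
    using k by (rule continuous_on_subset) auto
  then have "(\<lambda>s. exp (a * (s - t)) * k s) integrable_on {0..t}"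
    by (intro integrable_continuous_interval continuous_intros)
  then have "norm (integral {0..t} (\<lambda>s. exp (a * (s - t)) *\<^sub>R r s))
      \<le> integral {0..t} (\<lambda>s. exp (a * (s - t)) * k s)"
    using int r by (intro integral_norm_bound_integral) auto
  then show ?thesis
    using integral_unique[OF int] by simp
qed

section \<open>The Newton flow\<close>

text \<open>Substituting the equation for the gradient, the derivative of \<open>f\<close> along the
  flow is -\<beta> times the Hessian form at the velocity, hence non-positive.\<close>

lemma newton_solution_energy:
  fixes f :: "'a::euclidean_space \<Rightarrow> real"
  assumes f: "twice_continuously_differentiable f"
    and H: "\<And>y v. hess f y v \<bullet> v \<ge> 0"
    and x: "newton_solution f \<beta> x0 x" and "\<beta> > 0" "t \<ge> 0"
  shows "f (x t) \<le> f x0"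
proof -
  have x': "(x has_vector_derivative tderiv x s) (at s within {0..})" if "s \<ge> 0" for s
    using x that by (auto simp: newton_solution_def intro: has_vector_derivative_tderiv)
  have "((\<lambda>s. f (x s)) has_vector_derivative grad f (x s) \<bullet> tderiv x s)
      (at s within {0..})" if "s \<ge> 0" for s
    using f x'[OF that]
    by (intro has_vector_derivative_comp_grad) (auto simp: twice_continuously_differentiable_def)
  moreover have "grad f (x s) \<bullet> tderiv x s \<le> 0" if "s \<ge> 0" for s
  proof -
    have "grad f (x s) = - (\<beta> *\<^sub>R hess f (x s) (tderiv x s))"
      using x that by (simp add: newton_solution_def add_eq_0_iff)
    then show ?thesis
      using H[of "x s" "tderiv x s"] \<open>\<beta> > 0\<close> by simp
  qed
  ultimately have "f (x t) \<le> f (x 0)"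
    using \<open>t \<ge> 0\<close> by (rule has_vector_derivative_nonpos_imp_le)
  then show ?thesis
    using x by (simp add: newton_solution_def)
qed

lemma newton_solution_grad:
  fixes f :: "'a::euclidean_space \<Rightarrow> real"
  assumes f: "twice_continuously_differentiable f"
    and x: "newton_solution f \<beta> x0 x" and "\<beta> > 0" "t \<ge> 0"
  shows "grad f (x t) = exp (- t / \<beta>) *\<^sub>R grad f x0"
proof -
  have "((\<lambda>s. grad f (x s)) has_vector_derivative 0 - (1 / \<beta>) *\<^sub>R grad f (x s))
      (at s within {0..})" if "s \<ge> 0" for s
  proof -
    have "grad f (x s) = - (\<beta> *\<^sub>R hess f (x s) (tderiv x s))"
      using x that by (simp add: newton_solution_def add_eq_0_iff)
    then have "hess f (x s) (tderiv x s) = 0 - (1 / \<beta>) *\<^sub>R grad f (x s)"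
      using \<open>\<beta> > 0\<close> by simp
    moreover have "((\<lambda>s. grad f (x s)) has_vector_derivative hess f (x s) (tderiv x s))
        (at s within {0..})"
      using f x that
      by (intro has_vector_derivative_comp_hess has_vector_derivative_tderiv)
         (auto simp: twice_continuously_differentiable_def newton_solution_def)
    ultimately show ?thesis by simp
  qed
  \<comment> \<open>With zero forcing the bound says that a norm is at most 0, which gives
    equality.\<close>
  from linear_decay_bound[OF this, of "\<lambda>_. 0" t] show ?thesis
    using \<open>t \<ge> 0\<close> x by (simp add: newton_solution_def)
qed

section \<open>The inertial flow\<close>

text \<open>Taking the inner product of the equation with the velocity removes the acceleration from
  the derivative of the energy. What remains are three non-positive terms, from the decrease of
  \<epsilon>, the damping \<alpha> and the Hessian.\<close>

lemma inertial_solution_energy: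
  fixes f :: "'a::euclidean_space \<Rightarrow> real"
  assumes f: "twice_continuously_differentiable f"
    and H: "\<And>y v. hess f y v \<bullet> v \<ge> 0"
    and x: "inertial_solution f \<beta> \<epsilon> \<alpha> x0 v0 x" and "\<beta> > 0" "t \<ge> 0"
    and \<alpha>: "\<And>t. t \<ge> 0 \<Longrightarrow> \<alpha> t \<ge> 0"
    and \<epsilon>: "antimono_on {0..} \<epsilon>" "\<epsilon> differentiable_on {0..}"
  shows "f (x t) + \<epsilon> t / 2 * (norm (tderiv x t))\<^sup>2 \<le> f x0 + \<epsilon> 0 / 2 * (norm v0)\<^sup>2"
proof -
  define v where "v = tderiv x"
  define E where "E = (\<lambda>s. f (x s) + \<epsilon> s / 2 * (v s \<bullet> v s))"
  define E' where "E' = (\<lambda>s. grad f (x s) \<bullet> v s + tderiv \<epsilon> s / 2 * (v s \<bullet> v s)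
      + \<epsilon> s * (tderiv v s \<bullet> v s))"
  have "(E has_vector_derivative E' s) (at s within {0..})" if "s \<ge> 0" for s
  proof -
    have "((\<lambda>s. f (x s)) has_vector_derivative grad f (x s) \<bullet> v s) (at s within {0..})"
      using f x that unfolding v_def
      by (intro has_vector_derivative_comp_grad has_vector_derivative_tderiv)
         (auto simp: twice_continuously_differentiable_def inertial_solution_def)
    moreover have v': "(v has_vector_derivative tderiv v s) (at s within {0..})"
      using x that unfolding v_def
      by (intro has_vector_derivative_tderiv) (auto simp: inertial_solution_def)
    moreover have "((\<lambda>s. v s \<bullet> v s) has_vector_derivative 2 * (tderiv v s \<bullet> v s))
        (at s within {0..})"
      using bounded_bilinear.has_vector_derivative[OF bounded_bilinear_inner v' v']
      by (simp add: inner_commute)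
    moreover have "(\<epsilon> has_vector_derivative tderiv \<epsilon> s) (at s within {0..})"
      using \<epsilon>(2) that by (rule has_vector_derivative_tderiv)
    ultimately show ?thesis
      unfolding E_def E'_def has_real_derivative_iff_has_vector_derivative[symmetric]
      by (auto intro!: derivative_eq_intros)
  qed
  moreover have "E' s \<le> 0" if "s \<ge> 0" for s
  proof -
    have "(\<epsilon> s *\<^sub>R tderiv v s + \<alpha> s *\<^sub>R v s + \<beta> *\<^sub>R hess f (x s) (v s) + grad f (x s)) \<bullet> v s = 0"
      using x that by (simp add: inertial_solution_def v_def)
    then have "E' s = tderiv \<epsilon> s / 2 * (v s \<bullet> v s) - \<alpha> s * (v s \<bullet> v s)
        - \<beta> * (hess f (x s) (v s) \<bullet> v s)"
      by (simp add: E'_def inner_add_left)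
    moreover have "tderiv \<epsilon> s / 2 * (v s \<bullet> v s) \<le> 0"
      using antimono_on_tderiv_nonpos[OF \<epsilon> that] by (simp add: mult_nonpos_nonneg)
    moreover have "\<alpha> s * (v s \<bullet> v s) \<ge> 0" "\<beta> * (hess f (x s) (v s) \<bullet> v s) \<ge> 0"
      using \<alpha>[OF that] H[of "x s" "v s"] \<open>\<beta> > 0\<close> by simp_all
    ultimately show ?thesis by simp
  qed
  ultimately have "E t \<le> E 0"
    using \<open>t \<ge> 0\<close> by (rule has_vector_derivative_nonpos_imp_le)
  then show ?thesis
    using x by (simp add: E_def v_def inertial_solution_def power2_norm_eq_inner)
qed

text \<open>Working with \<open>w\<close> keeps the acceleration, for which no bound is available,
  out of the forcing. The velocity bound with constant \<open>c\<close> is used twice: for the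
  forcing, which gives the integral, and for recovering the gradient from \<open>w\<close>, which
  gives the term in \<open>sqrt (\<epsilon> t)\<close>.\<close>

lemma inertial_solution_grad:
  fixes f :: "'a::euclidean_space \<Rightarrow> real"
  assumes f: "twice_continuously_differentiable f"
    and x: "inertial_solution f \<beta> \<epsilon> \<alpha> x0 v0 x" and "\<beta> > 0" "t \<ge> 0"
    and \<alpha>: "\<And>t. t \<ge> 0 \<Longrightarrow> \<alpha> t \<ge> 0" "\<And>t. t \<ge> 0 \<Longrightarrow> \<alpha> t \<le> c2 * \<epsilon> t"
    and \<epsilon>: "\<epsilon> differentiable_on {0..}" "\<And>t. t \<ge> 0 \<Longrightarrow> \<epsilon> t > 0"
      "\<And>t. t \<ge> 0 \<Longrightarrow> \<bar>tderiv \<epsilon> t\<bar> \<le> c1 * \<epsilon> t"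
    and c: "c1 \<ge> 0" "c2 \<ge> 0"
    and v: "\<And>t. t \<ge> 0 \<Longrightarrow> \<epsilon> t * norm (tderiv x t) \<le> c * sqrt (\<epsilon> t)"
  shows "\<beta> * norm (grad f (x t) - exp (- t / \<beta>) *\<^sub>R grad f x0)
    \<le> exp (- t / \<beta>) * \<epsilon> 0 * norm v0 + c * sqrt (\<epsilon> t)
      + (c1 + c2 + 1 / \<beta>) * c * integral {0..t} (\<lambda>s. exp (1 / \<beta> * (s - t)) * sqrt (\<epsilon> s))"
proof -
  define v where "v = tderiv x"
  define w where "w = (\<lambda>s. \<epsilon> s *\<^sub>R v s + \<beta> *\<^sub>R grad f (x s))"
  define r where "r = (\<lambda>s. (tderiv \<epsilon> s - \<alpha> s + \<epsilon> s / \<beta>) *\<^sub>R v s)"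
  define C where "C = (c1 + c2 + 1 / \<beta>) * c"
  have w': "(w has_vector_derivative r s - (1 / \<beta>) *\<^sub>R w s) (at s within {0..})" if "s \<ge> 0" for s
  proof -
    have "((\<lambda>s. grad f (x s)) has_vector_derivative hess f (x s) (v s)) (at s within {0..})"
      using f x that unfolding v_def
      by (intro has_vector_derivative_comp_hess has_vector_derivative_tderiv)
         (auto simp: twice_continuously_differentiable_def inertial_solution_def)
    moreover have "(v has_vector_derivative tderiv v s) (at s within {0..})"
      using x that unfolding v_def
      by (intro has_vector_derivative_tderiv) (auto simp: inertial_solution_def)
    moreover have "(\<epsilon> has_real_derivative tderiv \<epsilon> s) (at s within {0..})"
      using has_vector_derivative_tderiv[OF \<epsilon>(1) that]
      by (simp add: has_real_derivative_iff_has_vector_derivative)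
    ultimately have "(w has_vector_derivative
        \<epsilon> s *\<^sub>R tderiv v s + tderiv \<epsilon> s *\<^sub>R v s + \<beta> *\<^sub>R hess f (x s) (v s)) (at s within {0..})"
      unfolding w_def by (auto intro!: derivative_eq_intros)
    moreover have "\<epsilon> s *\<^sub>R tderiv v s + \<alpha> s *\<^sub>R v s + \<beta> *\<^sub>R hess f (x s) (v s) + grad f (x s) = 0"
      using x that by (simp add: inertial_solution_def v_def)
    then have grad_eq: "grad f (x s)
        = - (\<epsilon> s *\<^sub>R tderiv v s + \<alpha> s *\<^sub>R v s + \<beta> *\<^sub>R hess f (x s) (v s))"
      unfolding eq_neg_iff_add_eq_0 by (simp only: add.commute)
    \<comment> \<open>The share of \<open>w\<close> containing the velocity cancels the summand
      \<open>\<epsilon> s / \<beta>\<close> in \<open>r\<close>. This leaves the velocity times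
      \<open>tderiv \<epsilon> s - \<alpha> s\<close>, minus the gradient, which
      \<open>grad_eq\<close> then rewrites.\<close>
    have "\<epsilon> s *\<^sub>R tderiv v s + tderiv \<epsilon> s *\<^sub>R v s + \<beta> *\<^sub>R hess f (x s) (v s)
        = r s - (1 / \<beta>) *\<^sub>R w s"
      using \<open>\<beta> > 0\<close> by (simp add: r_def w_def grad_eq algebra_simps)
    ultimately show ?thesis by simp
  qed
  have r_bound: "norm (r s) \<le> C * sqrt (\<epsilon> s)" if "s \<ge> 0" for s
  proof -
    have "\<bar>tderiv \<epsilon> s - \<alpha> s + \<epsilon> s / \<beta>\<bar> \<le> c1 * \<epsilon> s + c2 * \<epsilon> s + \<epsilon> s / \<beta>"
      using \<alpha>[OF that] \<epsilon>(3)[OF that] divide_pos_pos[OF \<epsilon>(2)[OF that] \<open>\<beta> > 0\<close>] by linarith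
    also have "\<dots> = (c1 + c2 + 1 / \<beta>) * \<epsilon> s"
      by (simp add: algebra_simps)
    finally have "norm (r s) \<le> (c1 + c2 + 1 / \<beta>) * \<epsilon> s * norm (v s)"
      by (simp add: r_def mult_right_mono)
    also have "\<dots> \<le> (c1 + c2 + 1 / \<beta>) * (c * sqrt (\<epsilon> s))"
      using v[OF that] c \<open>\<beta> > 0\<close> by (simp add: v_def mult.assoc mult_left_mono)
    finally show ?thesis by (simp add: C_def mult.assoc)
  qed
  have "continuous_on {0..} (\<lambda>s. C * sqrt (\<epsilon> s))"
    using differentiable_imp_continuous_on[OF \<epsilon>(1)] by (intro continuous_intros)
  from linear_decay_bound[OF w' r_bound this \<open>t \<ge> 0\<close>]
  have "norm (w t - exp (- t / \<beta>) *\<^sub>R w 0)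
      \<le> integral {0..t} (\<lambda>s. exp (1 / \<beta> * (s - t)) * (C * sqrt (\<epsilon> s)))"
    by simp
  also have "\<dots> = C * integral {0..t} (\<lambda>s. exp (1 / \<beta> * (s - t)) * sqrt (\<epsilon> s))"
    by (simp only: mult.left_commute[of _ C] integral_mult_right)
  finally have w_bound: "norm (w t - exp (- t / \<beta>) *\<^sub>R w 0) \<le> \<dots>" .
  have "w 0 = \<epsilon> 0 *\<^sub>R v0 + \<beta> *\<^sub>R grad f x0"
    using x by (simp add: w_def v_def inertial_solution_def)
  \<comment> \<open>Solving the definition of \<open>w\<close> for the gradient at time
    \<open>t\<close> and at time 0 leaves three pieces, one for each term of the claimed
    bound.\<close>
  then have "\<beta> *\<^sub>R (grad f (x t) - exp (- t / \<beta>) *\<^sub>R grad f x0)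
      = (w t - exp (- t / \<beta>) *\<^sub>R w 0) + (exp (- t / \<beta>) * \<epsilon> 0) *\<^sub>R v0 - \<epsilon> t *\<^sub>R v t"
    by (simp add: w_def algebra_simps)
  then have "norm (\<beta> *\<^sub>R (grad f (x t) - exp (- t / \<beta>) *\<^sub>R grad f x0))
      \<le> norm (w t - exp (- t / \<beta>) *\<^sub>R w 0) + norm ((exp (- t / \<beta>) * \<epsilon> 0) *\<^sub>R v0)
        + norm (\<epsilon> t *\<^sub>R v t)"
    by (metis (no_types, lifting) norm_triangle_ineq norm_triangle_ineq4 add_right_mono order_trans)
  then show ?thesis
    using w_bound v[OF \<open>t \<ge> 0\<close>] \<open>\<beta> > 0\<close> \<epsilon>(2)[of 0] \<epsilon>(2)[OF \<open>t \<ge> 0\<close>]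
    by (simp add: C_def v_def abs_mult)
qed

section \<open>Comparison of the two trajectories\<close>

theorem theorem3p1:
  fixes f :: "'a::euclidean_space \<Rightarrow> real"
    and \<beta> \<epsilon>0 \<epsilon>0' \<alpha>0 c1 c2 :: real
    and x0 v0 :: 'a
    and xN :: "real \<Rightarrow> 'a"
  assumes "convex_on UNIV f"
    and "twice_continuously_differentiable f"
    and "coercive f"
    and "strongly_convex_on_bounded f"
    and "\<beta> > 0"
    and "\<epsilon>0 > 0" and "\<epsilon>0' \<le> 0" and "\<alpha>0 \<ge> 0"
    and "newton_solution f \<beta> x0 xN"
    and "c1 \<ge> 0" and "c2 \<ge> 0"
  shows "\<exists>C0 C1 C2 :: real. C0 \<ge> 0 \<and> C1 \<ge> 0 \<and> C2 \<ge> 0 \<and>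
    (\<forall>(\<epsilon> :: real \<Rightarrow> real) (\<alpha> :: real \<Rightarrow> real) (x :: real \<Rightarrow> 'a).
       antimono_on {0..} \<alpha> \<and> (\<forall>t\<ge>0. \<alpha> t \<ge> 0) \<and> \<alpha> differentiable_on {0..} \<and> \<alpha> 0 = \<alpha>0 \<and>
       antimono_on {0..} \<epsilon> \<and> (\<forall>t\<ge>0. \<epsilon> t > 0) \<and>
       \<epsilon> differentiable_on {0..} \<and> tderiv \<epsilon> differentiable_on {0..} \<and>
       bounded (tderiv (tderiv \<epsilon>) ` {0..}) \<and> \<epsilon> 0 = \<epsilon>0 \<and> tderiv \<epsilon> 0 = \<epsilon>0' \<and>
       (\<forall>t\<ge>0. \<bar>tderiv \<epsilon> t\<bar> \<le> c1 * \<epsilon> t \<and> \<alpha> t \<le> c2 * \<epsilon> t) \<and>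
       inertial_solution f \<beta> \<epsilon> \<alpha> x0 v0 x \<longrightarrow>
       (\<forall>t\<ge>0. norm (x t - xN t)
          \<le> C0 * exp (- t / \<beta>) * \<epsilon>0 * norm v0 + C1 * sqrt (\<epsilon> t)
            + C2 * integral {0..t} (\<lambda>s. exp (1 / \<beta> * (s - t)) * sqrt (\<epsilon> s))))"
proof -
  note f = assms(2) and newton = assms(9)
  have f_diff: "f differentiable (at y)" "grad f differentiable (at y)" for y
    using f by (auto simp: twice_continuously_differentiable_def)
  \<comment> \<open>Monotonicity on the whole space follows by taking the two-point set as the
    bounded set; the modulus may vary with the pair since only the sign matters.\<close>
  have "(grad f y1 - grad f y2) \<bullet> (y1 - y2) \<ge> 0" for y1 y2
  proof -
    obtain \<mu> where "\<mu> > 0" "(grad f y1 - grad f y2) \<bullet> (y1 - y2) \<ge> \<mu> * (norm (y1 - y2))\<^sup>2"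
      using assms(4)[unfolded strongly_convex_on_bounded_def, rule_format, of "{y1, y2}"] by auto
    then show ?thesis
      by (smt (verit) mult_nonneg_nonneg zero_le_power2)
  qed
  then have H: "hess f y v \<bullet> v \<ge> 0" for y v
    using f_diff(2) by (rule hess_nonneg[rotated])
  \<comment> \<open>The initial energy of the inertial flow. As
    \<open>\<epsilon> 0 = \<epsilon>0\<close> is prescribed, it is the same for all admissible
    \<epsilon> and \<alpha>, and so are \<open>R\<close>, \<open>m\<close> and \<open>\<mu>\<close>
    obtained from it.\<close>
  define M where "M = f x0 + \<epsilon>0 / 2 * (norm v0)\<^sup>2"
  have "eventually (\<lambda>y. f y > M) at_infinity"
    using assms(3) by (simp add: coercive_def filterlim_at_top_dense)
  then obtain R where R: "\<And>y. norm y \<ge> R \<Longrightarrow> f y > M"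
    by (auto simp: eventually_at_infinity)
  have K: "y \<in> cball 0 R" if "f y \<le> M" for y
    using R[of y] that by force
  have "continuous_on (cball 0 R) f"
    using f_diff(1)
    by (auto intro!: differentiable_imp_continuous_on differentiable_at_imp_differentiable_on)
  then have "bounded (f ` cball 0 R)"
    by (intro compact_imp_bounded compact_continuous_image) auto
  then have "bdd_below (f ` cball 0 R)"
    by (rule bounded_imp_bdd_below)
  \<comment> \<open>A lower bound of \<open>f\<close> on the ball lets the energy control the
    kinetic term alone.\<close>
  then obtain m where m: "\<And>y. y \<in> cball 0 R \<Longrightarrow> m \<le> f y"
    unfolding bdd_below_def by blast
  obtain \<mu> where \<mu>: "\<mu> > 0"
    "\<And>y1 y2. y1 \<in> cball 0 R \<Longrightarrow> y2 \<in> cball 0 R \<Longrightarrow>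
      (grad f y1 - grad f y2) \<bullet> (y1 - y2) \<ge> \<mu> * (norm (y1 - y2))\<^sup>2"
    using assms(4)[unfolded strongly_convex_on_bounded_def, rule_format, of "cball 0 R"] by auto
  \<comment> \<open>Strong convexity and Cauchy-Schwarz, after cancelling one factor of the
    distance.\<close>
  have dist_le: "\<mu> * norm (y1 - y2) \<le> norm (grad f y1 - grad f y2)"
    if "y1 \<in> cball 0 R" "y2 \<in> cball 0 R" for y1 y2
  proof (cases "y1 = y2")
    case False
    have "\<mu> * norm (y1 - y2) * norm (y1 - y2) \<le> norm (grad f y1 - grad f y2) * norm (y1 - y2)"
      using \<mu>(2)[OF that] norm_cauchy_schwarz[of "grad f y1 - grad f y2" "y1 - y2"]
      by (simp add: power2_eq_square mult.assoc)
    then show ?thesis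
      using False by simp
  qed simp
  have "x0 \<in> cball 0 R"
    using assms(6) by (intro K) (simp add: M_def)
  then have "m \<le> M"
    using m[of x0] assms(6) by (simp add: M_def add_increasing2)
  \<comment> \<open>The kinetic energy is at most \<open>M - m\<close>, so
    \<open>sqrt (\<epsilon> s)\<close> times the speed is at most \<open>c\<close>. Below,
    \<open>C0\<close> removes the factor \<open>\<beta>\<close> of the gradient estimate and the
    factor \<open>\<mu>\<close> of \<open>dist_le\<close>.\<close>
  define c where "c = sqrt (2 * (M - m))"
  define C0 where "C0 = 1 / (\<beta> * \<mu>)"
  have "C0 \<ge> 0" "c \<ge> 0"
    using \<open>\<mu> > 0\<close> \<open>\<beta> > 0\<close> \<open>m \<le> M\<close> by (simp_all add: C0_def c_def)
  show ?thesis
  proof (rule exI[of _ C0], rule exI[of _ "C0 * c"],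
      rule exI[of _ "C0 * ((c1 + c2 + 1 / \<beta>) * c)"], intro conjI allI impI)
    show "0 \<le> C0 * c" "0 \<le> C0 * ((c1 + c2 + 1 / \<beta>) * c)"
      using \<open>C0 \<ge> 0\<close> \<open>c \<ge> 0\<close> assms(5,10,11) by simp_all
  next
    fix \<epsilon> \<alpha> :: "real \<Rightarrow> real" and x :: "real \<Rightarrow> 'a" and t :: real
    assume *: "antimono_on {0..} \<alpha> \<and> (\<forall>t\<ge>0. \<alpha> t \<ge> 0) \<and> \<alpha> differentiable_on {0..} \<and> \<alpha> 0 = \<alpha>0 \<and>
       antimono_on {0..} \<epsilon> \<and> (\<forall>t\<ge>0. \<epsilon> t > 0) \<and>
       \<epsilon> differentiable_on {0..} \<and> tderiv \<epsilon> differentiable_on {0..} \<and>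
       bounded (tderiv (tderiv \<epsilon>) ` {0..}) \<and> \<epsilon> 0 = \<epsilon>0 \<and> tderiv \<epsilon> 0 = \<epsilon>0' \<and>
       (\<forall>t\<ge>0. \<bar>tderiv \<epsilon> t\<bar> \<le> c1 * \<epsilon> t \<and> \<alpha> t \<le> c2 * \<epsilon> t) \<and>
       inertial_solution f \<beta> \<epsilon> \<alpha> x0 v0 x"
      and "t \<ge> 0"
    then have \<epsilon>_pos: "\<epsilon> s > 0" if "s \<ge> 0" for s
      using that by blast
    have energy: "f (x s) + \<epsilon> s / 2 * (norm (tderiv x s))\<^sup>2 \<le> M" if "s \<ge> 0" for s
      using inertial_solution_energy[OF f H, of \<beta> \<epsilon> \<alpha> x0 v0 x s] * that \<open>\<beta> > 0\<close>
      by (simp add: M_def)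
    have x_K: "x s \<in> cball 0 R" if "s \<ge> 0" for s
    proof (rule K)
      have "\<epsilon> s / 2 * (norm (tderiv x s))\<^sup>2 \<ge> 0"
        using \<epsilon>_pos[OF that] by simp
      then show "f (x s) \<le> M"
        using energy[OF that] by linarith
    qed
    have v_bound: "\<epsilon> s * norm (tderiv x s) \<le> c * sqrt (\<epsilon> s)" if "s \<ge> 0" for s
    proof -
      have "\<epsilon> s * (norm (tderiv x s))\<^sup>2 \<le> 2 * (M - m)"
        using energy[OF that] m[OF x_K[OF that]] by simp
      \<comment> \<open>Multiplying by \<open>\<epsilon> s\<close> completes the square on the left,
        and the root of the extra factor supplies \<open>sqrt (\<epsilon> s)\<close>.\<close>
      then have "(\<epsilon> s * norm (tderiv x s))\<^sup>2 \<le> 2 * (M - m) * \<epsilon> s"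
        using \<epsilon>_pos[OF that] by (simp add: power2_eq_square ac_simps)
      then have "\<epsilon> s * norm (tderiv x s) \<le> sqrt (2 * (M - m) * \<epsilon> s)"
        by (rule real_le_rsqrt)
      then show ?thesis
        by (simp add: c_def real_sqrt_mult)
    qed
    \<comment> \<open>The Newton trajectory stays below \<open>f x0\<close>, and \<open>M\<close>
      exceeds this by a non-negative kinetic term, so one ball serves both flows.\<close>
    have "xN t \<in> cball 0 R"
      using newton_solution_energy[OF f H newton \<open>\<beta> > 0\<close> \<open>t \<ge> 0\<close>] \<open>\<epsilon>0 > 0\<close>
      by (intro K) (simp add: M_def add_increasing2)
    then have "\<mu> * norm (x t - xN t) \<le> norm (grad f (x t) - exp (- t / \<beta>) *\<^sub>R grad f x0)"
      using dist_le[OF x_K[OF \<open>t \<ge> 0\<close>], of "xN t"]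
        newton_solution_grad[OF f newton \<open>\<beta> > 0\<close> \<open>t \<ge> 0\<close>] by simp
    then have "\<beta> * (\<mu> * norm (x t - xN t))
        \<le> \<beta> * norm (grad f (x t) - exp (- t / \<beta>) *\<^sub>R grad f x0)"
      using \<open>\<beta> > 0\<close> by simp
    also have "\<dots> \<le> exp (- t / \<beta>) * \<epsilon> 0 * norm v0 + c * sqrt (\<epsilon> t)
      + (c1 + c2 + 1 / \<beta>) * c * integral {0..t} (\<lambda>s. exp (1 / \<beta> * (s - t)) * sqrt (\<epsilon> s))"
      by (rule inertial_solution_grad[OF f, where \<alpha> = \<alpha>])
         (use * \<open>\<beta> > 0\<close> \<open>t \<ge> 0\<close> assms(10,11) v_bound in auto)
    finally have "C0 * (\<beta> * (\<mu> * norm (x t - xN t))) \<le> C0 * \<dots>"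
      using \<open>C0 \<ge> 0\<close> by (rule mult_left_mono)
    moreover have "C0 * (\<beta> * (\<mu> * norm (x t - xN t))) = norm (x t - xN t)"
      using \<open>\<beta> > 0\<close> \<open>\<mu> > 0\<close> by (simp add: C0_def)
    moreover have "\<epsilon> 0 = \<epsilon>0"
      using * by blast
    ultimately show "norm (x t - xN t)
          \<le> C0 * exp (- t / \<beta>) * \<epsilon>0 * norm v0 + C0 * c * sqrt (\<epsilon> t)
            + C0 * ((c1 + c2 + 1 / \<beta>) * c) * integral {0..t} (\<lambda>s. exp (1 / \<beta> * (s - t)) * sqrt (\<epsilon> s))"
      by (simp only: distrib_left mult.assoc)
  qed (rule \<open>C0 \<ge> 0\<close>)
qed

end
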